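(* Let $\alpha\in(0,1)\setminus\mathbb{Q}$ with partial quotients $a_1,a_2,\dots$, and let $n_0=\sup\{n:a_n=1\}$. If $n_0<\infty$ and $$\liminf_{n\to+\infty}\frac{\sum_{k=n_0+1}^n\log(a_k-1)}{\sum_{k=n_0+1}^n\log(a_k+1)}>0,$$ then $\dim_H(\mathcal{V}_\alpha)>0$.
   Context: $\dim_H$ denotes Hausdorff dimension. Let $\alpha\in(0,1)\setminus\mathbb{Q}$ have the regular continued fraction expansion $\alpha=\cfrac{1}{a_1+\cfrac{1}{a_2+\cdots}}$ with partial quotients $a_n\in\mathbb{N}$, $n\ge1$. Define $p_1=0$, $p_2=1$, $q_1=1$, $q_2=a_1$, and $p_{n+1}=a_np_n+p_{n-1}$, $q_{n+1}=a_nq_n+q_{n-1}$ for $n\ge2$. Put $\alpha_n=|q_n\alpha-p_n|$ for $n\ge1$. Let $Z_\alpha=\prod_{n=1}^\infty\{0,1,\dots,a_n\}$, and let $\mathcal{V}_\alpha$ be the set of all $x\in(0,1)$ for which there exists exactly one sequence $(x_1,x_2,\dots)\in Z_\alpha$ with $x=\sum_{n=1}^\infty x_n\alpha_n$. Convention: $n_0=0$ if $a_n\ne1$ for all $n\ge1$. *)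

theory Defs
  imports "HOL-Analysis.Analysis"
begin

text \<open>Contribution of a covering set \<open>U\<close> to the \<open>s\<close>-dimensional Hausdorff pre-measure. The case split is
  the convention \<open>0^0 = 1\<close> for nonempty sets (in HOL \<open>0 powr 0 = 0\<close>), so that the case \<open>s = 0\<close> gives
  the counting measure.\<close>

definition diam_pow :: "real \<Rightarrow> 'a::metric_space set \<Rightarrow> ennreal" where
  "diam_pow s U =
    (if U = {} then 0 else if s = 0 then 1 else ennreal (diameter U powr s))"

text \<open>Boundedness of the covering sets has to be required explicitly because \<open>diameter\<close> is
  unspecified on unbounded sets. Finite covers are included by padding with empty sets.\<close>

definition hausdorff_premeasure :: "real \<Rightarrow> real \<Rightarrow> 'a::metric_space set \<Rightarrow> ennreal" where
  "hausdorff_premeasure s \<delta> A =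
    Inf {\<Sum>i. diam_pow s (U i) | U :: nat \<Rightarrow> 'a set.
           A \<subseteq> (\<Union>i. U i) \<and> (\<forall>i. bounded (U i) \<and> diameter (U i) \<le> \<delta>)}"

definition hausdorff_measure :: "real \<Rightarrow> 'a::metric_space set \<Rightarrow> ennreal" where
  "hausdorff_measure s A = (SUP \<delta>\<in>{0<..}. hausdorff_premeasure s \<delta> A)"

definition hausdorff_dim :: "'a::metric_space set \<Rightarrow> ennreal" where
  "hausdorff_dim A = Inf {ennreal s | s. 0 \<le> s \<and> hausdorff_measure s A = 0}"

text \<open>All sequences below are indexed from 1; the value \<open>a 0\<close> is never used.
  \<open>cfrac_trunc a m k\<close> is the finite continued fraction with the \<open>k\<close> partial quotients
  \<open>a m, \<dots>, a (m + k - 1)\<close> and integer part 0.\<close>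

fun cfrac_trunc :: "(nat \<Rightarrow> nat) \<Rightarrow> nat \<Rightarrow> nat \<Rightarrow> real" where
  "cfrac_trunc a m 0 = 0"
| "cfrac_trunc a m (Suc k) = 1 / (real (a m) + cfrac_trunc a (Suc m) k)"

definition has_cfrac :: "real \<Rightarrow> (nat \<Rightarrow> nat) \<Rightarrow> bool" where
  "has_cfrac \<alpha> a \<longleftrightarrow> (\<forall>n\<ge>1. a n \<ge> 1) \<and> (\<lambda>k. cfrac_trunc a 1 k) \<longlonglongrightarrow> \<alpha>"

text \<open>The indexing is shifted by one against the usual convention: \<open>p 1 = 0, p 2 = 1\<close> and
  \<open>q 1 = 1, q 2 = a 1\<close>. The values at index 2 come out of the recurrence via the auxiliary
  values \<open>p 0 = 1\<close> and \<open>q 0 = 0\<close>.\<close>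

fun cf_p :: "(nat \<Rightarrow> nat) \<Rightarrow> nat \<Rightarrow> nat" where
  "cf_p a 0 = 1"
| "cf_p a (Suc 0) = 0"
| "cf_p a (Suc (Suc n)) = a (Suc n) * cf_p a (Suc n) + cf_p a n"

fun cf_q :: "(nat \<Rightarrow> nat) \<Rightarrow> nat \<Rightarrow> nat" where
  "cf_q a 0 = 0"
| "cf_q a (Suc 0) = 1"
| "cf_q a (Suc (Suc n)) = a (Suc n) * cf_q a (Suc n) + cf_q a n"

definition cf_err :: "real \<Rightarrow> (nat \<Rightarrow> nat) \<Rightarrow> nat \<Rightarrow> real" where
  "cf_err \<alpha> a n = \<bar>real (cf_q a n) * \<alpha> - real (cf_p a n)\<bar>"

text \<open>\<open>PiE\<close> makes the sequences undefined at the irrelevant index 0, so uniqueness concerns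
  the digits at indices \<open>n \<ge> 1\<close> only.\<close>

definition Z_set :: "(nat \<Rightarrow> nat) \<Rightarrow> (nat \<Rightarrow> nat) set" where
  "Z_set a = PiE {1..} (\<lambda>n. {0..a n})"

definition V_set :: "real \<Rightarrow> (nat \<Rightarrow> nat) \<Rightarrow> real set" where
  "V_set \<alpha> a =
    {y \<in> {0<..<1}. \<exists>!x. x \<in> Z_set a \<and> (\<lambda>n. real (x (Suc n)) * cf_err \<alpha> a (Suc n)) sums y}"

text \<open>The supremum is 0 if no partial quotient equals 1.\<close>

definition last_one :: "(nat \<Rightarrow> nat) \<Rightarrow> enat" where
  "last_one a = Sup (enat ` {n. n \<ge> 1 \<and> a n = 1})"

end

theory Submission
  imports Defs
begin

text \<open>
  Write \<open>b n\<close> for the remainder \<open>\<bar>q\<^sub>n \<alpha> - p\<^sub>n\<bar>\<close>, with \<open>b 0 = 1\<close>. The remainders are positive and satisfy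
  \<open>b n = a (n + 1) b (n + 1) + b (n + 2)\<close>, so that \<open>\<Sum>\<^bsub>k > n\<^esub> a k b k\<close> telescopes to at most
  \<open>b n + b (n + 1)\<close>, and \<open>\<Sum>\<^bsub>k > n\<^esub> (a k - 1) b k < b n\<close> (\<open>tail_less\<close>). The last inequality says that a
  change of the digit at \<open>n\<close> cannot be undone by later digits that change by at most \<open>a k - 1\<close>.
  Hence every sequence with \<open>x n = 0\<close> for \<open>n \<le> n\<^sub>0\<close> and \<open>1 \<le> x n \<le> a n - 1\<close> for \<open>n > n\<^sub>0\<close> is the only
  expansion of its value (\<open>unique_expansion\<close>): a competitor with digits up to \<open>a n\<close> gains at most
  \<open>a n - 1\<close> over \<open>x\<close> wherever \<open>x n \<ge> 1\<close>.

  To get positive dimension, only the digits \<open>1, \<dots>, m n\<close> with \<open>m n = \<lfloor>(a n + 1) / 2\<rfloor>\<close> are used after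
  \<open>n\<^sub>0\<close>. They vary by at most \<open>(a n - 1) / 2\<close>, so the later digits make up for at most half of a change
  at the first different position: values whose digits first differ at \<open>n\<close>, by \<open>d\<close>, are at least
  \<open>d b n / 2\<close> apart. With the full digit range, the gap between neighbouring cylinders at level \<open>n\<close> can be
  of the order of \<open>b (n + 1)\<close>, which the hypothesis does not bound below by a power of the measure of a cylinder.
  On the other hand \<open>(m n)\<^sup>2 \<ge> a n - 1\<close>, so halving the digits costs at most a factor 2 in
  the logarithm of the number \<open>M n\<close> of digit blocks up to \<open>n\<close>. Since \<open>b n\<close> is, up to a constant, at
  least \<open>1 / \<Prod>\<^bsub>n\<^sub>0 < k \<le> n\<^esub> (a k + 1)\<close>, the hypothesis on the limit inferior yields
  \<open>M n \<ge> K / (b n)\<^sup>s\<close> for some \<open>s, K > 0\<close> (\<open>digits_upto_lower_bound\<close>).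

  The dimension bound follows without a mass distribution: read the mixed radix digits of
  \<open>t \<in> [0, 1)\<close> with radices \<open>m n\<close> as an expansion in the remainders. The resulting
  map \<open>g\<close> from \<open>[0, 1)\<close> to the set of unique expansions satisfies
  \<open>\<bar>t - u\<bar> \<le> C \<bar>g t - g u\<bar>\<^sup>s\<close> (\<open>expansion_expanding\<close>), so a cover of the set pulls back to a cover of
  \<open>[0, 1)\<close>, which has Lebesgue measure 1 (\<open>hausdorff_dim_ge_expanding\<close>).
\<close>

section \<open>A lower bound for the Hausdorff dimension\<close>

text \<open>
  The preimage in \<open>[0, 1)\<close> of a set of diameter \<open>D\<close> lies in an interval of length \<open>2 C D\<^sup>s\<close>. The
  preimages of a cover therefore give \<open>1 \<le> 2 C \<Sum> D\<^sub>i\<^sup>s\<close>. For an exponent \<open>r < s\<close> it is enough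
  to look at covers with \<open>D\<^sub>i \<le> 1\<close>, for which \<open>D\<^sub>i\<^sup>s \<le> D\<^sub>i\<^sup>r\<close>.
\<close>
lemma hausdorff_dim_ge_expanding:
  fixes g :: "real \<Rightarrow> 'a::metric_space"
  assumes "C > 0"
    and into: "\<And>t. t \<in> {0..<1} \<Longrightarrow> g t \<in> A"
    and expanding: "\<And>t u. t \<in> {0..<1} \<Longrightarrow> u \<in> {0..<1} \<Longrightarrow> \<bar>t - u\<bar> \<le> C * dist (g t) (g u) powr s"
  shows "ennreal s \<le> hausdorff_dim A"
  unfolding hausdorff_dim_def
proof (rule Inf_greatest, clarify)
  fix r :: real
  assume r: "0 \<le> r" "hausdorff_measure r A = 0"
  show "ennreal s \<le> ennreal r"
  proof (rule ccontr)
    assume "\<not> ?thesis"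
    hence "r < s" by (simp add: ennreal_leI not_le) (meson ennreal_leI leD leI)
    have cover: "ennreal 1 \<le> ennreal (2 * C) * (\<Sum>i. diam_pow r (U i))"
      if U: "A \<subseteq> (\<Union>i. U i)" "\<And>i. bounded (U i)" "\<And>i. diameter (U i) \<le> 1" for U :: "nat \<Rightarrow> 'a set"
    proof -
      \<comment> \<open>Preimages need not be measurable, so each is enlarged to a closed interval about one of its points.\<close>
      define T where "T i = {t \<in> {0..<1}. g t \<in> U i}" for i
      define L where "L i = C * diameter (U i) powr s" for i
      define J where "J i = (if T i = {} then {} else cball (SOME t. t \<in> T i) (L i))" for i
      have TJ: "T i \<subseteq> J i" for i
      proof
        fix t assume t: "t \<in> T i"
        define u where "u = (SOME t. t \<in> T i)"
        have u: "u \<in> T i" unfolding u_def using t by (rule someI)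
        have "\<bar>u - t\<bar> \<le> C * dist (g u) (g t) powr s"
          using expanding[of u t] t u by (auto simp: T_def)
        also have "dist (g u) (g t) \<le> diameter (U i)"
          using t u U(2) by (intro diameter_bounded_bound) (auto simp: T_def)
        hence "C * dist (g u) (g t) powr s \<le> L i"
          using \<open>C > 0\<close> \<open>r < s\<close> r by (auto simp: L_def intro!: powr_mono2)
        finally show "t \<in> J i" using t by (auto simp: J_def u_def dist_real_def)
      qed
      have sub: "{0..<1} \<subseteq> (\<Union>i. J i)"
      proof
        fix t :: real assume t: "t \<in> {0..<1}"
        then obtain i where "g t \<in> U i" using U(1) into[OF t] by auto
        hence "t \<in> T i" using t by (simp add: T_def)
        thus "t \<in> (\<Union>i. J i)" using TJ by auto
      qed
      have J: "emeasure lborel (J i) \<le> ennreal (2 * C) * diam_pow r (U i)" for i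
      proof (cases "T i = {}")
        case False
        hence ne: "U i \<noteq> {}" by (auto simp: T_def)
        have d0: "diameter (U i) \<ge> 0" using U(2) by (rule diameter_ge_0)
        have "emeasure lborel (J i) = ennreal (2 * L i)"
          using False \<open>C > 0\<close> by (simp add: J_def cball_eq_atLeastAtMost L_def)
        also have "\<dots> = ennreal (2 * C) * ennreal (diameter (U i) powr s)"
          using \<open>C > 0\<close> by (simp add: L_def ennreal_mult[symmetric] mult.assoc)
        also have "ennreal (diameter (U i) powr s) \<le> diam_pow r (U i)"
        proof (cases "r = 0")
          case True
          have "diameter (U i) powr s \<le> 1"
            using d0 U(3)[of i] \<open>r < s\<close> r powr_mono2[of s "diameter (U i)" 1] by simp
          thus ?thesis using True ne by (simp add: diam_pow_def)
        next
          case False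
          have "diameter (U i) powr s \<le> diameter (U i) powr r"
            using d0 U(3)[of i] \<open>r < s\<close> by (cases "diameter (U i) = 0") (auto intro: powr_mono')
          thus ?thesis using False ne by (simp add: diam_pow_def ennreal_leI)
        qed
        finally show ?thesis by (simp add: mult_left_mono)
      qed (simp add: J_def)
      have "ennreal 1 = emeasure lborel {0..<1::real}" by simp
      also have "\<dots> \<le> emeasure lborel (\<Union>i. J i)"
        using sub by (rule emeasure_mono) (auto simp: J_def)
      also have "\<dots> \<le> (\<Sum>i. emeasure lborel (J i))"
        by (rule emeasure_subadditive_countably) (auto simp: J_def)
      also have "\<dots> \<le> (\<Sum>i. ennreal (2 * C) * diam_pow r (U i))"
        by (intro suminf_le J) auto
      finally show ?thesis by (simp add: ennreal_suminf_cmult)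
    qed
    have "ennreal (1 / (2 * C)) \<le> hausdorff_premeasure r 1 A"
      unfolding hausdorff_premeasure_def
    proof (rule Inf_greatest, clarify)
      fix U :: "nat \<Rightarrow> 'a set"
      assume "A \<subseteq> (\<Union>i. U i)" "\<forall>i. bounded (U i) \<and> diameter (U i) \<le> 1"
      hence "ennreal 1 \<le> ennreal (2 * C) * (\<Sum>i. diam_pow r (U i))" by (intro cover) auto
      hence "ennreal (1 / (2 * C)) * ennreal 1 
          \<le> ennreal (1 / (2 * C)) * (ennreal (2 * C) * (\<Sum>i. diam_pow r (U i)))"
        by (rule mult_left_mono) simp
      thus "ennreal (1 / (2 * C)) \<le> (\<Sum>i. diam_pow r (U i))"
        using \<open>C > 0\<close> by (simp add: mult.assoc[symmetric] ennreal_mult[symmetric])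
    qed
    also have "\<dots> \<le> hausdorff_measure r A"
      unfolding hausdorff_measure_def by (rule SUP_upper) simp
    finally show False using r \<open>C > 0\<close> by simp
  qed
qed

section \<open>Expansions in the remainders of a continued fraction\<close>

text \<open>
  Here \<open>b n\<close> stands for the distance of \<open>q\<^sub>n \<alpha>\<close> from \<open>p\<^sub>n\<close>. The theory of expansions rests on
  positivity and the recurrence alone.
\<close>
locale cf_remainders =
  fixes a :: "nat \<Rightarrow> nat" and b :: "nat \<Rightarrow> real"
  assumes quot_pos: "n \<ge> 1 \<Longrightarrow> a n \<ge> 1"
    and rem_pos: "b n > 0"
    and rem_rec: "b n = real (a (Suc n)) * b (Suc n) + b (Suc (Suc n))"
begin

lemma rem_Suc_le: "b (Suc n) \<le> b n"
proof -
  have "1 * b (Suc n) \<le> real (a (Suc n)) * b (Suc n)"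
    using quot_pos[of "Suc n"] rem_pos[of "Suc n"] by (intro mult_right_mono) auto
  thus ?thesis using rem_rec[of n] rem_pos[of "Suc (Suc n)"] by simp
qed

lemma rem_ratio_le: "b n \<le> (real (a (Suc n)) + 1) * b (Suc n)"
  using rem_rec[of n] rem_Suc_le[of "Suc n"] by (simp add: algebra_simps)

text \<open>The recurrence reads \<open>a (k + 1) b (k + 1) = b k - b (k + 2)\<close>, so the sum telescopes with step 2.\<close>
lemma sum_quot_rem:
  "(\<Sum>i<L. real (a (Suc (N + i))) * b (Suc (N + i))) = b N + b (Suc N) - b (N + L) - b (Suc (N + L))"
proof (induction L)
  case (Suc L)
  show ?case using Suc rem_rec[of "N + L"] by simp
qed simp

lemma summable_quot_rem: "summable (\<lambda>i. real (a (Suc (N + i))) * b (Suc (N + i)))"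
proof (rule summableI_nonneg_bounded)
  fix L
  show "(\<Sum>i<L. real (a (Suc (N + i))) * b (Suc (N + i))) \<le> b N + b (Suc N)"
    using rem_pos[of "N + L"] rem_pos[of "Suc (N + L)"] by (simp only: sum_quot_rem)
qed (simp add: rem_pos less_imp_le)

lemma suminf_quot_rem_le: "(\<Sum>i. real (a (Suc (N + i))) * b (Suc (N + i))) \<le> b N + b (Suc N)"
proof (rule suminf_le_const[OF summable_quot_rem])
  fix L
  show "(\<Sum>i<L. real (a (Suc (N + i))) * b (Suc (N + i))) \<le> b N + b (Suc N)"
    using rem_pos[of "N + L"] rem_pos[of "Suc (N + L)"] by (simp only: sum_quot_rem)
qed

lemma summable_digits:
  fixes w :: "nat \<Rightarrow> real"
  assumes "\<And>n. n > N \<Longrightarrow> \<bar>w n\<bar> \<le> a n"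
  shows "summable (\<lambda>i. w (Suc (N + i)) * b (Suc (N + i)))"
proof (rule summable_comparison_test[OF _ summable_quot_rem[of N]], intro exI allI impI)
  fix i
  show "norm (w (Suc (N + i)) * b (Suc (N + i))) \<le> real (a (Suc (N + i))) * b (Suc (N + i))"
    using assms[of "Suc (N + i)"] rem_pos[of "Suc (N + i)"] by (simp add: abs_mult mult_right_mono)
qed

lemma rem_tendsto_0: "b \<longlonglongrightarrow> 0"
proof -
  have "summable (\<lambda>i. (\<lambda>_. 1) (Suc (0 + i)) * b (Suc (0 + i)))"
    by (rule summable_digits) (use quot_pos in force)
  hence "(\<lambda>i. b (Suc i)) \<longlonglongrightarrow> 0" by (simp add: summable_LIMSEQ_zero)
  thus ?thesis by (simp add: filterlim_sequentially_Suc)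
qed

text \<open>
  Subtracting \<open>\<Sum> b k\<close> from the telescoped sum removes more than the surplus \<open>b (N + 1)\<close>. The constant
  \<open>c\<close> is 1 for uniqueness of expansions and \<open>1 / 2\<close> for their separation.
\<close>
lemma tail_less:
  fixes w :: "nat \<Rightarrow> real"
  assumes c: "c > 0"
    and w: "\<And>n. n > N \<Longrightarrow> w n \<le> c * (real (a n) - 1)"
    and sw: "summable (\<lambda>i. w (Suc (N + i)) * b (Suc (N + i)))"
  shows "(\<Sum>i. w (Suc (N + i)) * b (Suc (N + i))) < c * b N"
proof -
  have sb: "summable (\<lambda>i. b (Suc (N + i)))"
    using summable_digits[of N "\<lambda>_. 1"] quot_pos by force
  have s: "summable (\<lambda>i. real (a (Suc (N + i))) * b (Suc (N + i)) - b (Suc (N + i)))"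
    by (intro summable_diff summable_quot_rem sb)
  have "(\<Sum>i. w (Suc (N + i)) * b (Suc (N + i))) 
      \<le> (\<Sum>i. c * (real (a (Suc (N + i))) * b (Suc (N + i)) - b (Suc (N + i))))"
  proof (rule suminf_le[OF _ sw summable_mult[OF s]])
    fix i
    have "w (Suc (N + i)) * b (Suc (N + i)) \<le> c * (real (a (Suc (N + i))) - 1) * b (Suc (N + i))"
      using w[of "Suc (N + i)"] rem_pos[of "Suc (N + i)"] by (intro mult_right_mono) auto
    thus "w (Suc (N + i)) * b (Suc (N + i)) 
        \<le> c * (real (a (Suc (N + i))) * b (Suc (N + i)) - b (Suc (N + i)))"
      by (simp add: algebra_simps)
  qed
  also have "\<dots> = c * ((\<Sum>i. real (a (Suc (N + i))) * b (Suc (N + i))) - (\<Sum>i. b (Suc (N + i))))"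
    using s by (simp add: suminf_mult suminf_diff[OF summable_quot_rem sb])
  also have "\<dots> < c * b N"
  proof -
    have "(\<Sum>i<2. b (Suc (N + i))) \<le> (\<Sum>i. b (Suc (N + i)))"
      by (rule sum_le_suminf[OF sb]) (auto simp: rem_pos less_imp_le)
    hence "b (Suc N) < (\<Sum>i. b (Suc (N + i)))"
      using rem_pos[of "Suc (Suc N)"] by (simp add: numeral_2_eq_2)
    thus ?thesis using c suminf_quot_rem_le[of N] by simp
  qed
  finally show ?thesis .
qed

text \<open>
  In the applications \<open>v\<close> is the difference of two digit sequences and \<open>N\<close> the first place where they
  differ.
\<close>
lemma leading_digit_dominates:
  fixes v :: "nat \<Rightarrow> real"
  assumes c: "c > 0" and N: "N \<ge> 1"
    and v0: "\<And>n. 1 \<le> n \<Longrightarrow> n < N \<Longrightarrow> v n = 0"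
    and v: "\<And>n. n > N \<Longrightarrow> - v n \<le> c * (real (a n) - 1)"
    and sm: "(\<lambda>i. v (Suc i) * b (Suc i)) sums y"
  shows "(v N - c) * b N < y"
proof -
  have sv: "summable (\<lambda>i. v (Suc i) * b (Suc i))" using sm by (rule sums_summable)
  have st: "summable (\<lambda>i. v (Suc (N + i)) * b (Suc (N + i)))"
    using summable_ignore_initial_segment[OF sv, of N] by (simp add: add.commute)
  have "y = (\<Sum>i. v (Suc (i + N)) * b (Suc (i + N))) + (\<Sum>i<N. v (Suc i) * b (Suc i))"
    using suminf_split_initial_segment[OF sv, of N] sums_unique[OF sm] by simp
  also have "(\<Sum>i<N. v (Suc i) * b (Suc i)) = (\<Sum>i\<in>{N - 1}. v (Suc i) * b (Suc i))"
    by (rule sum.mono_neutral_right) (use N v0 in auto)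
  also have "\<dots> = v N * b N" using N by simp
  finally have y: "y = (\<Sum>i. v (Suc (N + i)) * b (Suc (N + i))) + v N * b N"
    by (simp add: add.commute)
  have "(\<Sum>i. - v (Suc (N + i)) * b (Suc (N + i))) < c * b N"
    using st by (intro tail_less[OF c v, where N = N]) (simp_all add: summable_minus)
  also have "(\<Sum>i. - v (Suc (N + i)) * b (Suc (N + i))) = - (\<Sum>i. v (Suc (N + i)) * b (Suc (N + i)))"
    using suminf_minus[OF st] by simp
  finally show ?thesis using y by (simp add: algebra_simps)
qed

definition expansion :: "(nat \<Rightarrow> nat) \<Rightarrow> real" where
  "expansion x = (\<Sum>i. real (x (Suc i)) * b (Suc i))"

lemma expansion_sums:
  assumes "\<And>n. n \<ge> 1 \<Longrightarrow> x n \<le> a n"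
  shows "(\<lambda>i. real (x (Suc i)) * b (Suc i)) sums expansion x"
  unfolding expansion_def
  using summable_digits[of 0 "\<lambda>n. real (x n)"] assms by (simp add: summable_sums)

text \<open>
  Let \<open>N\<close> be the first place where \<open>x\<close> and \<open>y\<close> differ. If \<open>x N > y N\<close>, then \<open>x N \<noteq> 0\<close> and so \<open>N > n0\<close>;
  after \<open>N\<close>, the digits of \<open>y\<close> exceed those of \<open>x\<close> by at most \<open>a n - 1\<close> because \<open>x n \<ge> 1\<close>. If
  \<open>x N < y N\<close>, then the digits of \<open>x\<close> exceed those of \<open>y\<close> by at most \<open>x n \<le> a n - 1\<close>. In both cases the
  tail cannot make up for the difference at \<open>N\<close>. The zeros up to \<open>n0\<close> allow partial quotients equal
  to 1 there.
\<close>
lemma unique_expansion: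
  fixes x y :: "nat \<Rightarrow> nat"
  assumes x: "\<And>n. 1 \<le> n \<Longrightarrow> n \<le> n0 \<Longrightarrow> x n = 0" "\<And>n. n > n0 \<Longrightarrow> 1 \<le> x n \<and> x n + 1 \<le> a n"
    and y: "\<And>n. n \<ge> 1 \<Longrightarrow> y n \<le> a n"
    and sx: "(\<lambda>i. real (x (Suc i)) * b (Suc i)) sums z"
    and sy: "(\<lambda>i. real (y (Suc i)) * b (Suc i)) sums z"
    and "n \<ge> 1"
  shows "y n = x n"
proof (rule ccontr)
  assume "y n \<noteq> x n"
  define N where "N = (LEAST n. n \<ge> 1 \<and> y n \<noteq> x n)"
  have N: "N \<ge> 1" "y N \<noteq> x N"
    using LeastI[of "\<lambda>n. n \<ge> 1 \<and> y n \<noteq> x n" n] \<open>n \<ge> 1\<close> \<open>y n \<noteq> x n\<close> by (auto simp: N_def)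
  have agree: "y k = x k" if "1 \<le> k" "k < N" for k
    using not_less_Least[of k "\<lambda>n. n \<ge> 1 \<and> y n \<noteq> x n"] that by (auto simp: N_def)
  show False
  proof (cases "x N > y N")
    case True
    hence "N > n0" using x(1)[of N] N by (cases "N \<le> n0") auto
    have "(real (x N) - real (y N) - 1) * b N < z - z"
    proof (rule leading_digit_dominates[where v = "\<lambda>n. real (x n) - real (y n)"])
      show "(\<lambda>i. (real (x (Suc i)) - real (y (Suc i))) * b (Suc i)) sums (z - z)"
        using sums_diff[OF sx sy] by (simp add: left_diff_distrib)
      fix k assume "k > N"
      thus "- (real (x k) - real (y k)) \<le> 1 * (real (a k) - 1)"
        using x(2)[of k] y[of k] \<open>N > n0\<close> by simp
    qed (use N agree in auto)
    thus False using True rem_pos[of N] by (simp add: mult_less_0_iff)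
  next
    case False
    have "(real (y N) - real (x N) - 1) * b N < z - z"
    proof (rule leading_digit_dominates[where v = "\<lambda>n. real (y n) - real (x n)"])
      show "(\<lambda>i. (real (y (Suc i)) - real (x (Suc i))) * b (Suc i)) sums (z - z)"
        using sums_diff[OF sy sx] by (simp add: left_diff_distrib)
      fix k assume "k > N"
      thus "- (real (y k) - real (x k)) \<le> 1 * (real (a k) - 1)"
        using x(2)[of k] x(1)[of k] quot_pos[of k] by (cases "k \<le> n0") auto
    qed (use N agree in auto)
    thus False using False N rem_pos[of N] by (simp add: mult_less_0_iff)
  qed
qed

lemma expansion_bounds:
  assumes x: "\<And>n. 1 \<le> n \<Longrightarrow> n \<le> n0 \<Longrightarrow> x n = 0" "\<And>n. n > n0 \<Longrightarrow> 1 \<le> x n \<and> x n + 1 \<le> a n"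
  shows "0 < expansion x" "expansion x < b 0"
proof -
  have le: "x n + 1 \<le> a n" if "n \<ge> 1" for n
    using x[of n] quot_pos[of n] that by (cases "n \<le> n0") auto
  have sm: "(\<lambda>i. real (x (Suc i)) * b (Suc i)) sums expansion x"
    by (rule expansion_sums) (use le in force)
  have "0 < (\<Sum>i. real (x (Suc i)) * b (Suc i))"
    by (rule suminf_pos2[where i = n0, OF sums_summable[OF sm]])
       (use x(2)[of "Suc n0"] rem_pos in \<open>auto simp: less_imp_le\<close>)
  thus "0 < expansion x" by (simp add: expansion_def)
  have "(\<Sum>i. real (x (Suc (0 + i))) * b (Suc (0 + i))) < 1 * b 0"
  proof (rule tail_less[where w = "\<lambda>n. real (x n)"])
    fix n :: nat assume "n > 0"
    thus "real (x n) \<le> 1 * (real (a n) - 1)" using le[of n] by simp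
  qed (use sums_summable[OF sm] in simp_all)
  thus "expansion x < b 0" by (simp add: expansion_def)
qed

end

section \<open>A Cantor set of unique expansions\<close>

lemma floor_refine:
  fixes m :: nat and z :: real
  assumes "m > 0"
  shows "0 \<le> \<lfloor>m * z\<rfloor> - int m * \<lfloor>z\<rfloor>" "\<lfloor>m * z\<rfloor> - int m * \<lfloor>z\<rfloor> < int m"
proof -
  have "real m * of_int \<lfloor>z\<rfloor> \<le> m * z" by (intro mult_left_mono) auto
  thus "0 \<le> \<lfloor>m * z\<rfloor> - int m * \<lfloor>z\<rfloor>" by (simp add: le_floor_iff)
  have "real m * z < real m * (real_of_int \<lfloor>z\<rfloor> + 1)" using assms by (intro mult_strict_left_mono) auto
  hence "\<lfloor>m * z\<rfloor> < int m * (\<lfloor>z\<rfloor> + 1)" by (simp add: floor_less_iff)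
  thus "\<lfloor>m * z\<rfloor> - int m * \<lfloor>z\<rfloor> < int m" by (simp add: algebra_simps)
qed

locale cf_cantor = cf_remainders +
  fixes n0 :: nat
  assumes quot_ge_2: "n > n0 \<Longrightarrow> a n \<ge> 2"
begin

definition digits_upto :: "nat \<Rightarrow> nat" where
  "digits_upto n = (\<Prod>k = n0 + 1..n. (a k + 1) div 2)"

text \<open>
  For \<open>n > n0\<close> this is one plus the digit at \<open>n\<close> of \<open>t\<close> in the mixed radix system with radices
  \<open>(a n + 1) div 2\<close>; the shift by one keeps the digit away from 0. The value at 0 is chosen such that the
  sequence belongs to the extensional product in the definition of \<open>Z_set\<close>.
\<close>
definition mixed_radix_digit :: "real \<Rightarrow> nat \<Rightarrow> nat" where
  "mixed_radix_digit t n = (if n = 0 then undefined else if n \<le> n0 then 0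
     else 1 + nat (\<lfloor>real (digits_upto n) * t\<rfloor> - int ((a n + 1) div 2) * \<lfloor>real (digits_upto (n - 1)) * t\<rfloor>))"

lemma digits_upto_init: "n \<le> n0 \<Longrightarrow> digits_upto n = 1"
  by (simp add: digits_upto_def)

lemma digits_upto_step: "n > n0 \<Longrightarrow> digits_upto n = digits_upto (n - 1) * ((a n + 1) div 2)"
  unfolding digits_upto_def by (cases n) (auto simp: prod.nat_ivl_Suc' mult.commute)

lemma digits_upto_pos: "digits_upto n > 0"
  unfolding digits_upto_def
proof (intro prod_pos)
  fix k assume "k \<in> {n0 + 1..n}"
  thus "0 < (a k + 1) div 2" using quot_ge_2[of k] by simp
qed

lemma mixed_radix_digit_range:
  assumes "n > n0"
  shows "int (mixed_radix_digit t n)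
      = 1 + \<lfloor>real (digits_upto n) * t\<rfloor> - int ((a n + 1) div 2) * \<lfloor>real (digits_upto (n - 1)) * t\<rfloor>"
    and "1 \<le> mixed_radix_digit t n" "mixed_radix_digit t n \<le> (a n + 1) div 2"
    and "mixed_radix_digit t n + 1 \<le> a n"
proof -
  have m: "(a n + 1) div 2 > 0" "(a n + 1) div 2 + 1 \<le> a n" using quot_ge_2[OF assms] by auto
  have "real (digits_upto n) * t = real ((a n + 1) div 2) * (real (digits_upto (n - 1)) * t)"
    using assms by (simp add: digits_upto_step)
  note fl = floor_refine[OF m(1), of "real (digits_upto (n - 1)) * t", folded this]
  show 1: "int (mixed_radix_digit t n)
      = 1 + \<lfloor>real (digits_upto n) * t\<rfloor> - int ((a n + 1) div 2) * \<lfloor>real (digits_upto (n - 1)) * t\<rfloor>"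
    using fl assms by (simp add: mixed_radix_digit_def)
  show "1 \<le> mixed_radix_digit t n" "mixed_radix_digit t n \<le> (a n + 1) div 2"
    using 1 fl by linarith+
  thus "mixed_radix_digit t n + 1 \<le> a n" using m by linarith
qed

lemma mixed_radix_digit_init: "1 \<le> n \<Longrightarrow> n \<le> n0 \<Longrightarrow> mixed_radix_digit t n = 0"
  by (simp add: mixed_radix_digit_def)

lemma mixed_radix_digit_le: "n \<ge> 1 \<Longrightarrow> mixed_radix_digit t n \<le> a n"
  using mixed_radix_digit_range(4)[of n t] mixed_radix_digit_init[of n t] by (cases "n \<le> n0") auto

text \<open>
  Here \<open>n\<close> is the first place where the digits of \<open>t\<close> and \<open>u\<close> differ and \<open>d\<close> is the difference there.
  The two bounds on \<open>t - u\<close> are complementary: the first uses that the digits agree up to \<open>n - 1\<close>, the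
  second that at \<open>n\<close> they differ by \<open>d\<close>. The hypothesis \<open>large\<close> guarantees that they differ somewhere.
\<close>
lemma expansion_separated:
  assumes t: "t \<in> {0..<1}" "u \<in> {0..<1}" and "u < t"
    and large: "\<exists>n. 1 \<le> real (digits_upto n) * (t - u)"
  obtains n d where "n > n0" "d \<ge> (1::real)" "real (digits_upto (n - 1)) * (t - u) \<le> 1"
    "real (digits_upto n) * (t - u) \<le> 2 * d"
    "d * b n \<le> 2 * (expansion (mixed_radix_digit t) - expansion (mixed_radix_digit u))"
proof -
  let ?F = "\<lambda>n t. \<lfloor>real (digits_upto n) * t\<rfloor>"
  define n where "n = (LEAST n. ?F n t \<noteq> ?F n u)"
  obtain k where "1 \<le> real (digits_upto k) * (t - u)" using large by blast
  hence "?F k t \<noteq> ?F k u" by (simp add: right_diff_distrib) linarith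
  hence n: "?F n t \<noteq> ?F n u" unfolding n_def by (rule LeastI)
  have same: "?F k t = ?F k u" if "k < n" for k
    using not_less_Least[of k "\<lambda>n. ?F n t \<noteq> ?F n u"] that by (auto simp: n_def)
  have fl0: "\<lfloor>t\<rfloor> = 0" "\<lfloor>u\<rfloor> = 0" using t by (auto simp: floor_eq_iff)
  have "n > n0"
    using n fl0 digits_upto_init[of n] by (cases "n \<le> n0") auto
  define d where "d = real_of_int (?F n t - ?F n u)"
  have "real (digits_upto n) * u \<le> real (digits_upto n) * t" using \<open>u < t\<close> by (simp add: mult_left_mono)
  hence "?F n u \<le> ?F n t" by (rule floor_mono)
  hence d: "d \<ge> 1" using n unfolding d_def by linarith
  have 1: "real (digits_upto (n - 1)) * (t - u) \<le> 1"
    using same[of "n - 1"] \<open>n > n0\<close> by (simp add: right_diff_distrib) linarith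
  have "real (digits_upto n) * (t - u) \<le> d + 1"
    unfolding d_def by (simp add: right_diff_distrib) linarith
  hence 2: "real (digits_upto n) * (t - u) \<le> 2 * d" using d by simp
  let ?v = "\<lambda>n. real (mixed_radix_digit t n) - real (mixed_radix_digit u n)"
  have "int (mixed_radix_digit t n) - int (mixed_radix_digit u n) = ?F n t - ?F n u"
    using mixed_radix_digit_range(1)[OF \<open>n > n0\<close>] same[of "n - 1"] \<open>n > n0\<close> by simp
  hence vn: "?v n = d" unfolding d_def by (metis of_int_diff of_int_of_nat_eq)
  have "(?v n - 1 / 2) * b n
      < expansion (mixed_radix_digit t) - expansion (mixed_radix_digit u)"
  proof (rule leading_digit_dominates[where v = ?v])
    show "(\<lambda>i. ?v (Suc i) * b (Suc i)) sums
        (expansion (mixed_radix_digit t) - expansion (mixed_radix_digit u))"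
      unfolding left_diff_distrib by (intro sums_diff expansion_sums mixed_radix_digit_le)
    fix k assume "k > n"
    hence "n0 < k" using \<open>n > n0\<close> by simp
    hence "1 \<le> mixed_radix_digit t k" "2 * mixed_radix_digit u k \<le> a k + 1"
      using mixed_radix_digit_range(2)[of k t] mixed_radix_digit_range(3)[of k u] by linarith+
    hence "1 \<le> real (mixed_radix_digit t k)" "2 * real (mixed_radix_digit u k) \<le> real (a k) + 1"
      by linarith+
    \<comment> \<open>The restriction to the lower half of the digits enters here.\<close>
    thus "- ?v k \<le> 1 / 2 * (real (a k) - 1)" by simp
  next
    fix k assume "1 \<le> k" "k < n"
    thus "?v k = 0"
      using same[of k] same[of "k - 1"] by (simp add: mixed_radix_digit_def)
  qed (use \<open>n > n0\<close> in auto)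
  moreover have "d * b n \<le> 2 * ((?v n - 1 / 2) * b n)"
    using mult_right_mono[of 1 d "b n"] d rem_pos[of n] unfolding vn by (simp add: algebra_simps)
  moreover have "p \<le> 2 * q" if "r < q" "p \<le> 2 * r" for p q r :: real using that by linarith
  ultimately have 3: "d * b n
      \<le> 2 * (expansion (mixed_radix_digit t) - expansion (mixed_radix_digit u))" by blast
  show thesis using that[OF \<open>n > n0\<close> d 1 2 3] .
qed

text \<open>
  Let the digits first differ at \<open>n\<close>, by \<open>d\<close>, and let \<open>M\<close> be the number of digit blocks up to
  \<open>n - 1\<close>. The two bounds on \<open>t - u\<close> are combined as \<open>M (t - u) \<le> (M (t - u))\<^sup>s \<le> (2 d / m)\<^sup>s\<close>, which
  uses \<open>M (t - u) \<le> 1\<close> and \<open>s \<le> 1\<close>. By \<open>K \<le> M (b (n - 1))\<^sup>s\<close>, this gives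
  \<open>K (t - u) \<le> (2 d b (n - 1) / m)\<^sup>s\<close>, and \<open>b (n - 1)\<close> is at most \<open>4 m b n\<close>. A large partial quotient
  at \<open>n\<close> therefore does no harm.
\<close>
lemma expansion_expanding:
  assumes K: "K > 0" "\<And>n. K \<le> digits_upto n * b n powr s" and s: "0 < s" "s \<le> 1"
    and t: "t \<in> {0..<1}" "u \<in> {0..<1}" and "u < t"
  shows "t - u \<le> 16 powr s / K
      * dist (expansion (mixed_radix_digit t)) (expansion (mixed_radix_digit u)) powr s"
proof -
  let ?e = "dist (expansion (mixed_radix_digit t)) (expansion (mixed_radix_digit u))"
  \<comment> \<open>The number of digit blocks is unbounded because \<open>b n\<close> tends to 0, so \<open>t\<close> and \<open>u\<close> have different digits.\<close>
  have "(\<lambda>n. b n powr s) \<longlonglongrightarrow> 0"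
    by (rule tendsto_zero_powrI[OF rem_tendsto_0 tendsto_const]) (use s rem_pos in \<open>auto simp: less_imp_le\<close>)
  hence "eventually (\<lambda>n. b n powr s < K * (t - u)) sequentially"
    using K \<open>u < t\<close> by (intro order_tendstoD) auto
  then obtain k where k: "b k powr s < K * (t - u)" by (auto simp: eventually_sequentially)
  have "K \<le> digits_upto k * b k powr s" by (rule K)
  also have "\<dots> \<le> digits_upto k * (K * (t - u))" using k by (intro mult_left_mono) auto
  finally have "1 \<le> real (digits_upto k) * (t - u)" using K(1) by simp
  with expansion_separated[OF t \<open>u < t\<close>] obtain n d where n: "n > n0" and d: "d \<ge> 1"
    and small: "real (digits_upto (n - 1)) * (t - u) \<le> 1" "real (digits_upto n) * (t - u) \<le> 2 * d"
    and "d * b n \<le> 2 * (expansion (mixed_radix_digit t) - expansion (mixed_radix_digit u))" by blast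
  note this(5)
  also have "\<dots> \<le> 2 * ?e" unfolding dist_real_def by (intro mult_left_mono abs_ge_self) simp
  finally have sep: "d * b n \<le> 2 * ?e" .
  define m where "m = (a n + 1) div 2"
  define M where "M = real (digits_upto (n - 1))"
  have "m > 0" using quot_ge_2[OF n] by (simp add: m_def)
  have "M > 0" using digits_upto_pos by (simp add: M_def)
  have step: "digits_upto n = M * m" using n by (simp add: digits_upto_step M_def m_def)
  have "M * (t - u) = (M * (t - u)) powr 1" using \<open>M > 0\<close> \<open>u < t\<close> by simp
  also have "\<dots> \<le> (M * (t - u)) powr s"
    using small(1) \<open>M > 0\<close> \<open>u < t\<close> s by (intro powr_mono') (auto simp: M_def)
  also have "\<dots> \<le> (2 * d / m) powr s"
    using small(2) \<open>M > 0\<close> \<open>u < t\<close> \<open>m > 0\<close> s unfolding step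
    by (intro powr_mono2) (auto simp: field_simps)
  finally have *: "M * (t - u) \<le> (2 * d / m) powr s" .
  have "K * (t - u) \<le> M * b (n - 1) powr s * (t - u)"
    using K(2)[of "n - 1"] \<open>u < t\<close> by (intro mult_right_mono) (auto simp: M_def)
  also have "\<dots> \<le> (2 * d / m) powr s * b (n - 1) powr s"
    using mult_right_mono[OF *, of "b (n - 1) powr s"] by (simp add: mult_ac)
  also have "\<dots> = (2 * d / m * b (n - 1)) powr s"
    by (rule powr_mult[symmetric])
  also have "\<dots> \<le> (16 * ?e) powr s"
  proof (rule powr_mono2)
    have "b (n - 1) \<le> (real (a n) + 1) * b n" using n rem_ratio_le[of "n - 1"] by simp
    also have "\<dots> \<le> (4 * m) * b n"
      using quot_ge_2[OF n] rem_pos[of n] by (intro mult_right_mono) (auto simp: m_def)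
    finally have "2 * d / m * b (n - 1) \<le> 2 * d / m * (4 * m * b n)"
      using d by (intro mult_left_mono) auto
    also have "\<dots> = 8 * (d * b n)" using \<open>m > 0\<close> by simp
    finally show "2 * d / m * b (n - 1) \<le> 16 * ?e" using sep by linarith
  qed (use s d rem_pos[of "n - 1"] in auto)
  also have "\<dots> = 16 powr s * ?e powr s"
    by (rule powr_mult)
  finally show ?thesis using K(1) by (simp add: field_simps)
qed

text \<open>
  With \<open>m = (a k + 1) div 2\<close> one has \<open>m\<^sup>2 \<ge> (a k)\<^sup>2 / 4 \<ge> a k - 1\<close>, hence
  \<open>ln (digits_upto n)\<close> is at least half the sum of the \<open>ln (a k - 1)\<close>, and eventually at least \<open>c / 2\<close>
  times \<open>ln (P n)\<close> with \<open>P n\<close> the product of the \<open>a k + 1\<close>. Moreover \<open>P n * b n\<close> does not decrease,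
  which turns the lower bound in terms of \<open>P n\<close> into one in terms of \<open>b n\<close>.
\<close>
lemma digits_upto_lower_bound:
  assumes c: "c > 0"
    and ev: "eventually (\<lambda>n. c * (\<Sum>k = n0 + 1..n. ln (real (a k) + 1))
                            \<le> (\<Sum>k = n0 + 1..n. ln (real (a k) - 1))) sequentially"
  obtains K where "K > 0" "\<And>n. K \<le> digits_upto n * b n powr (c / 2)"
proof -
  define P where "P n = (\<Prod>k = n0 + 1..n. real (a k) + 1)" for n
  have Ppos: "P n > 0" for n unfolding P_def by (intro prod_pos) simp
  have lnP: "ln (P n) = (\<Sum>k = n0 + 1..n. ln (real (a k) + 1))" for n
    unfolding P_def by (rule ln_prod) simp_all
  have Pb: "b n0 \<le> P n * b n" if "n \<ge> n0" for n
    using that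
  proof (induction n rule: dec_induct)
    case (step n)
    have "P n * b n \<le> P n * ((real (a (Suc n)) + 1) * b (Suc n))"
      using Ppos[of n] rem_ratio_le by (intro mult_left_mono) auto
    thus ?case using step by (simp add: P_def mult_ac prod.nat_ivl_Suc')
  qed (simp add: P_def)
  have half: "(\<Sum>k = n0 + 1..n. ln (real (a k) - 1)) / 2 \<le> ln (digits_upto n)" for n
  proof -
    have "ln (real (digits_upto n)) = (\<Sum>k = n0 + 1..n. ln (real ((a k + 1) div 2)))"
      unfolding digits_upto_def of_nat_prod 
    proof (rule ln_prod)
      fix k assume "k \<in> {n0 + 1..n}"
      thus "real ((a k + 1) div 2) \<noteq> 0" using quot_ge_2[of k] by simp
    qed simp
    moreover have "(\<Sum>k = n0 + 1..n. ln (real (a k) - 1)) / 2 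
        \<le> (\<Sum>k = n0 + 1..n. ln (real ((a k + 1) div 2)))"
      unfolding sum_divide_distrib
    proof (rule sum_mono)
      fix k assume "k \<in> {n0 + 1..n}"
      hence a2: "a k \<ge> 2" using quot_ge_2[of k] by simp
      define m where "m = (a k + 1) div 2"
      have m: "real (a k) / 2 \<le> real m" "m > 0" using a2 by (auto simp: m_def)
      have "real (a k) - 1 \<le> (real (a k) / 2)\<^sup>2"
        using zero_le_power2[of "real (a k) / 2 - 1"] by (simp add: power2_eq_square algebra_simps)
      also have "\<dots> \<le> (real m)\<^sup>2" using m by (intro power_mono) auto
      finally have "ln (real (a k) - 1) \<le> ln ((real m)\<^sup>2)" using a2 by (intro ln_mono) auto
      also have "\<dots> = 2 * ln m" using m by (simp add: ln_realpow)
      finally show "ln (real (a k) - 1) / 2 \<le> ln (real m)" by simp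
    qed
    ultimately show ?thesis by simp
  qed
  have "eventually (\<lambda>n. b n0 powr (c / 2) \<le> digits_upto n * b n powr (c / 2)) sequentially"
    using ev eventually_ge_at_top[of n0]
  proof eventually_elim
    case (elim n)
    have "c / 2 * ln (P n) \<le> ln (digits_upto n)"
      using elim(1) half[of n] unfolding lnP by simp
    hence "P n powr (c / 2) \<le> exp (ln (digits_upto n))" using Ppos[of n] by (simp add: powr_def)
    also have "\<dots> = digits_upto n" using digits_upto_pos[of n] by simp
    finally have "P n powr (c / 2) * b n powr (c / 2) \<le> digits_upto n * b n powr (c / 2)"
      by (rule mult_right_mono) simp
    moreover have "b n0 powr (c / 2) \<le> (P n * b n) powr (c / 2)"
      using Pb[OF elim(2)] rem_pos[of n0] c by (intro powr_mono2) auto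
    ultimately show ?case unfolding powr_mult by linarith
  qed
  then obtain n1 where n1: "\<And>n. n \<ge> n1 \<Longrightarrow> b n0 powr (c / 2) \<le> digits_upto n * b n powr (c / 2)"
    by (auto simp: eventually_sequentially)
  \<comment> \<open>The finitely many places before \<open>n1\<close> only make the constant smaller.\<close>
  define S where "S = insert (b n0 powr (c / 2)) ((\<lambda>n. digits_upto n * b n powr (c / 2)) ` {..<n1})"
  have S: "finite S" "S \<noteq> {}" by (auto simp: S_def)
  have b0: "b n \<noteq> 0" for n using rem_pos[of n] by simp
  show thesis
  proof (rule that[of "Min S"])
    show "Min S > 0" using S b0 by (subst Min_gr_iff) (auto simp: S_def digits_upto_pos)
    fix n
    show "Min S \<le> digits_upto n * b n powr (c / 2)"
    proof (cases "n < n1")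
      case True
      thus ?thesis using S by (intro Min_le) (auto simp: S_def)
    next
      case False
      have "Min S \<le> b n0 powr (c / 2)" using S by (intro Min_le) (auto simp: S_def)
      thus ?thesis using n1[of n] False by simp
    qed
  qed
qed

end

section \<open>The remainders of an irrational number\<close>

lemma cf_q_pos:
  assumes "\<And>n. n \<ge> 1 \<Longrightarrow> a n \<ge> 1"
  shows "cf_q a (Suc n) > 0"
  by (induction n) (use assms in \<open>auto simp: Suc_le_eq\<close>)

lemma cfrac_trunc_nonneg: "cfrac_trunc a m k \<ge> 0"
  by (induction k arbitrary: m) (auto simp: add_nonneg_nonneg)

text \<open>
  The signs of \<open>q\<^sub>n \<alpha> - p\<^sub>n\<close> alternate. The induction carries along that the continued fraction
  starting at \<open>a (n + 1)\<close> converges to the quotient of two consecutive signed errors: inverting this limit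
  and subtracting \<open>a (n + 1)\<close> gives the next one, which is nonnegative as a limit of nonnegative
  numbers and nonzero because \<open>\<alpha>\<close> is irrational.
\<close>
lemma signed_error_pos:
  assumes irr: "\<alpha> \<in> {0<..<1} - \<rat>" and cf: "has_cfrac \<alpha> a"
  defines "e \<equiv> \<lambda>n. (-1) ^ Suc n * (real (cf_q a n) * \<alpha> - real (cf_p a n))"
  shows "e n > 0 \<and> e (Suc n) > 0 \<and> (\<lambda>k. cfrac_trunc a (Suc n) k) \<longlonglongrightarrow> e (Suc n) / e n"
proof (induction n)
  case 0
  show ?case using irr cf by (simp add: e_def has_cfrac_def)
next
  case (Suc n)
  have ge1: "a k \<ge> 1" if "k \<ge> 1" for k using cf that by (simp add: has_cfrac_def)
  have pos: "e n > 0" "e (Suc n) > 0" using Suc by auto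
  have rec: "e (Suc (Suc n)) = e n - a (Suc n) * e (Suc n)"
    by (simp add: e_def algebra_simps)
  have "(\<lambda>k. cfrac_trunc a (Suc n) (Suc k)) \<longlonglongrightarrow> e (Suc n) / e n"
    using Suc by (simp only: LIMSEQ_Suc)
  hence "(\<lambda>k. 1 / cfrac_trunc a (Suc n) (Suc k) - a (Suc n)) \<longlonglongrightarrow> 1 / (e (Suc n) / e n) - a (Suc n)"
    using pos by (intro tendsto_intros) auto
  moreover have "1 / cfrac_trunc a (Suc n) (Suc k) - a (Suc n) = cfrac_trunc a (Suc (Suc n)) k" for k
    by simp
  ultimately have lim: "(\<lambda>k. cfrac_trunc a (Suc (Suc n)) k) \<longlonglongrightarrow> e (Suc (Suc n)) / e (Suc n)"
    using pos by (simp add: rec diff_divide_distrib del: cfrac_trunc.simps)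
  hence "e (Suc (Suc n)) / e (Suc n) \<ge> 0"
    by (rule LIMSEQ_le_const) (use cfrac_trunc_nonneg in blast)
  hence "e (Suc (Suc n)) \<ge> 0" using pos by (simp add: zero_le_divide_iff)
  moreover have "e (Suc (Suc n)) \<noteq> 0"
  proof
    assume "e (Suc (Suc n)) = 0"
    hence "real (cf_q a (Suc (Suc n))) * \<alpha> = cf_p a (Suc (Suc n))" by (simp add: e_def del: cf_q.simps cf_p.simps)
    moreover have "cf_q a (Suc (Suc n)) > 0" by (rule cf_q_pos) (rule ge1)
    ultimately have "\<alpha> = real (cf_p a (Suc (Suc n))) / real (cf_q a (Suc (Suc n)))"
      by (simp add: field_simps del: cf_q.simps cf_p.simps)
    also have "\<dots> \<in> \<rat>" by simp
    finally show False using irr by simp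
  qed
  ultimately show ?case using pos lim by simp
qed

lemma cf_remainders_cf_err:
  assumes irr: "\<alpha> \<in> {0<..<1} - \<rat>" and cf: "has_cfrac \<alpha> a"
  shows "cf_remainders a (cf_err \<alpha> a)"
proof
  define e where "e n = (-1) ^ Suc n * (real (cf_q a n) * \<alpha> - real (cf_p a n))" for n
  have pos: "e n > 0" for n
    using signed_error_pos[OF irr cf, of n] by (simp add: e_def)
  have "\<bar>e n\<bar> = cf_err \<alpha> a n" for n
    by (simp add: e_def cf_err_def abs_mult power_abs)
  hence err: "cf_err \<alpha> a n = e n" for n
    using pos[of n] by (metis abs_of_pos)
  show "a n \<ge> 1" if "n \<ge> 1" for n using cf that by (simp add: has_cfrac_def)
  show "cf_err \<alpha> a n > 0" for n using pos err by simp
  show "cf_err \<alpha> a n = real (a (Suc n)) * cf_err \<alpha> a (Suc n) + cf_err \<alpha> a (Suc (Suc n))" for n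
    unfolding err by (simp add: e_def algebra_simps)
qed

lemma V_set_expansion:
  fixes \<alpha> :: real
  assumes "cf_cantor a (cf_err \<alpha> a) n0"
  shows "cf_remainders.expansion (cf_err \<alpha> a) (cf_cantor.mixed_radix_digit a n0 t) \<in> V_set \<alpha> a"
proof -
  interpret cf_cantor a "cf_err \<alpha> a" n0 by fact
  let ?x = "mixed_radix_digit t"
  note x = mixed_radix_digit_init[of _ t] mixed_radix_digit_range(2,4)[of _ t]
  have Z: "?x \<in> Z_set a"
    by (auto simp: Z_set_def PiE_iff extensional_def mixed_radix_digit_le)
       (simp add: mixed_radix_digit_def)
  have sm: "(\<lambda>i. real (?x (Suc i)) * cf_err \<alpha> a (Suc i)) sums expansion ?x"
    by (intro expansion_sums mixed_radix_digit_le)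
  have "cf_err \<alpha> a 0 = 1" by (simp add: cf_err_def)
  hence "expansion ?x \<in> {0<..<1}"
    using expansion_bounds[of n0 ?x] x by simp
  moreover have "y = ?x"
    if "y \<in> Z_set a" "(\<lambda>i. real (y (Suc i)) * cf_err \<alpha> a (Suc i)) sums expansion ?x" for y
  proof
    fix n
    show "y n = ?x n"
    proof (cases "n \<ge> 1")
      case True
      show ?thesis
      proof (rule unique_expansion[where ?n0.0 = n0, OF _ _ _ sm that(2) True])
        show "y k \<le> a k" if "k \<ge> 1" for k
          using \<open>y \<in> Z_set a\<close> that by (auto simp: Z_set_def PiE_iff)
      qed (use x in auto)
    next
      case False
      thus ?thesis using that(1) Z by (auto simp: Z_set_def PiE_iff extensional_def)
    qed
  qed
  ultimately show ?thesis using Z sm unfolding V_set_def by blast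
qed

theorem corollary3p19:
  fixes \<alpha> :: real and a :: "nat \<Rightarrow> nat"
  assumes "\<alpha> \<in> {0<..<1} - \<rat>"
    and "has_cfrac \<alpha> a"
    and "last_one a < \<infinity>"
    and "liminf (\<lambda>n. ereal (
           (\<Sum>k = the_enat (last_one a) + 1..n. ln (real (a k) - 1)) /
           (\<Sum>k = the_enat (last_one a) + 1..n. ln (real (a k) + 1)))) > 0"
  shows "hausdorff_dim (V_set \<alpha> a) > 0"
proof -
  define n0 where "n0 = the_enat (last_one a)"
  have n0: "last_one a = enat n0" using assms(3) unfolding n0_def by (cases "last_one a") auto
  have ge2: "a n \<ge> 2" if "n > n0" for n
  proof -
    have "a n \<noteq> 1"
    proof
      assume "a n = 1"
      hence "enat n \<le> last_one a" using that unfolding last_one_def by (intro Sup_upper) auto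
      thus False using that n0 by simp
    qed
    moreover have "a n \<ge> 1" using assms(2) that by (simp add: has_cfrac_def)
    ultimately show ?thesis by simp
  qed
  interpret cf_remainders a "cf_err \<alpha> a" by (rule cf_remainders_cf_err[OF assms(1,2)])
  interpret cf_cantor a "cf_err \<alpha> a" n0 by unfold_locales (rule ge2)
  let ?A = "\<lambda>n. \<Sum>k = n0 + 1..n. ln (real (a k) - 1)"
  let ?B = "\<lambda>n. \<Sum>k = n0 + 1..n. ln (real (a k) + 1)"
  from assms(4) obtain c0 where c0: "0 < ereal c0" "ereal c0 < liminf (\<lambda>n. ereal (?A n / ?B n))"
    unfolding n0_def by (meson ereal_dense2)
  define c where "c = min c0 1"
  have c: "0 < c" "c \<le> 1" using c0 by (auto simp: c_def)
  have "eventually (\<lambda>n. ereal c0 < ereal (?A n / ?B n)) sequentially"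
    using c0(2) by (rule less_LiminfD)
  hence ev: "eventually (\<lambda>n. c * ?B n \<le> ?A n) sequentially"
    using eventually_gt_at_top[of n0]
  proof eventually_elim
    case (elim n)
    have B: "?B n > 0"
    proof (rule sum_pos)
      fix k assume "k \<in> {n0 + 1..n}"
      thus "0 < ln (real (a k) + 1)" using ge2[of k] by simp
    qed (use elim(2) in auto)
    have "c * ?B n \<le> c0 * ?B n" using B by (intro mult_right_mono) (auto simp: c_def)
    also have "\<dots> \<le> ?A n" using elim(1) B by (simp add: field_simps)
    finally show ?case .
  qed
  obtain K where K: "K > 0" "\<And>n. K \<le> digits_upto n * cf_err \<alpha> a n powr (c / 2)"
    using digits_upto_lower_bound[OF c(1) ev] by blast
  let ?g = "\<lambda>t. expansion (mixed_radix_digit t)"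
  have "ennreal (c / 2) \<le> hausdorff_dim (V_set \<alpha> a)"
  proof (rule hausdorff_dim_ge_expanding[where g = ?g and C = "16 powr (c / 2) / K"])
    show "?g t \<in> V_set \<alpha> a" for t
      by (rule V_set_expansion) unfold_locales
    fix t u :: real
    assume t: "t \<in> {0..<1}" "u \<in> {0..<1}"
    have *: "v - w \<le> 16 powr (c / 2) / K * dist (?g v) (?g w) powr (c / 2)"
      if "w < v" "v \<in> {0..<1}" "w \<in> {0..<1}" for v w
      using c that by (intro expansion_expanding K) auto
    consider "u < t" | "t < u" | "t = u" by linarith
    thus "\<bar>t - u\<bar> \<le> 16 powr (c / 2) / K * dist (?g t) (?g u) powr (c / 2)"
      using *[of u t] *[of t u] t by cases (auto simp: dist_commute)
  qed (use K in auto)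
  moreover have "ennreal (c / 2) > 0" using c by simp
  ultimately show ?thesis by (rule less_le_trans[rotated])
qed

end
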